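(* Let $\mathcal{H}$ be a real Hilbert space, let $c:\mathcal{H}\to\mathbb{R}$ be convex and continuous, and let $C=\{x\in\mathcal{H}:c(x)\le0\}$. Suppose that $T:\mathcal{H}\rightrightarrows\mathcal{H}$ is $\mu$-strongly monotone for some $\mu>0$. Then the variational inequality: find $x^*\in C$ and $u^*\in T(x^* )$ such that $\langle u^*,x-x^*\rangle\ge0$ for all $x\in C$, has at most one solution $x^*$. Consequently, if its solution set $S^*$ is nonempty, then $S^*=\{x^*\}$ is a singleton.
   Context: For $T:\mathcal{H}\rightrightarrows\mathcal{H}$, $\operatorname{Gph}(T)=\{(x,u):u\in T(x)\}$. $T$ is $\mu$-strongly monotone if $\langle u-v,x-y\rangle\ge\mu\|x-y\|^2$ for all $(x,u),(y,v)\in\operatorname{Gph}(T)$. $S^*$ is the set of $x^*\in C$ for which there is $u^*\in T(x^* )$ with $\langle u^*,x-x^*\rangle\ge 0$ for all $x\in C$. *)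

theory Defs
  imports "HOL-Analysis.Analysis"
begin

(* A set-valued operator on H is a function into sets; empty values are allowed. *)

definition Gph :: "('a \<Rightarrow> 'b set) \<Rightarrow> ('a \<times> 'b) set" where
  "Gph T = {(x, u). u \<in> T x}"

(* The modulus mu is not required to be positive here; positivity is assumed where it is needed. *)

definition strongly_monotone :: "real \<Rightarrow> ('a::real_inner \<Rightarrow> 'a set) \<Rightarrow> bool" where
  "strongly_monotone \<mu> T \<longleftrightarrow>
     (\<forall>(x, u) \<in> Gph T. \<forall>(y, v) \<in> Gph T. inner (u - v) (x - y) \<ge> \<mu> * (norm (x - y))\<^sup>2)"

definition VI_solution :: "('a::real_inner \<Rightarrow> 'a set) \<Rightarrow> 'a set \<Rightarrow> 'a \<Rightarrow> 'a \<Rightarrow> bool" where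
  "VI_solution T C xs us \<longleftrightarrow> xs \<in> C \<and> us \<in> T xs \<and> (\<forall>x\<in>C. inner us (x - xs) \<ge> 0)"

definition VI_solution_set :: "('a::real_inner \<Rightarrow> 'a set) \<Rightarrow> 'a set \<Rightarrow> 'a set" where
  "VI_solution_set T C = {xs. \<exists>us. VI_solution T C xs us}"

end

theory Submission
  imports Defs
begin

text \<open>Two solutions are tested against each other: both lie in \<open>C\<close>, so each is
  admissible in the other's inequality. Adding the two gives
  \<open>inner (u - v) (x - y) \<le> 0\<close>, while strong monotonicity bounds this product below
  by \<open>\<mu> * (norm (x - y))\<^sup>2\<close>. Since \<open>\<mu> > 0\<close>, the points
  coincide.\<close>

lemma strongly_monotone_VI_solution_unique:
  assumes "\<mu> > 0" and "strongly_monotone \<mu> T"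
    and x: "VI_solution T C x u" and y: "VI_solution T C y v"
  shows "x = y"
proof -
  have "\<mu> * (norm (x - y))\<^sup>2 \<le> inner (u - v) (x - y)"
    using assms unfolding strongly_monotone_def Gph_def VI_solution_def by blast
  \<comment> \<open>The sign in the \<open>u\<close> term is flipped so that both products have the
    form occurring in the variational inequality.\<close>
  also have "\<dots> = - inner u (y - x) - inner v (x - y)"
    by (simp add: inner_diff_left inner_diff_right)
  also have "\<dots> \<le> 0"
  proof -
    have "inner u (y - x) \<ge> 0" "inner v (x - y) \<ge> 0"
      using x y unfolding VI_solution_def by blast+
    then show ?thesis by linarith
  qed
  finally have "(norm (x - y))\<^sup>2 \<le> 0"
    using \<open>\<mu> > 0\<close> by (simp add: mult_le_0_iff)
  then show ?thesis by simp
qed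

theorem proposition5p1:
  fixes c :: "'h::{real_inner, complete_space} \<Rightarrow> real"
    and C :: "'h set"
    and T :: "'h \<Rightarrow> 'h set"
    and \<mu> :: real
  assumes "convex_on UNIV c"
    and "continuous_on UNIV c"
    and "C = {x. c x \<le> 0}"
    and "\<mu> > 0"
    and "strongly_monotone \<mu> T"
  shows "(\<exists>\<^sub>\<le>\<^sub>1 xs. \<exists>us. VI_solution T C xs us) \<and>
         (VI_solution_set T C \<noteq> {} \<longrightarrow> (\<exists>xs. VI_solution_set T C = {xs}))"
proof -
  \<comment> \<open>The operator values \<open>u\<close> and \<open>v\<close> may differ, so
    uniqueness of the point is compatible with the existential over \<open>us\<close> in both
    conjuncts.\<close>
  have unique: "x = y" if "VI_solution T C x u" "VI_solution T C y v" for x y u v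
    using strongly_monotone_VI_solution_unique[OF assms(4,5) that] .
  show ?thesis
  proof
    show "\<exists>\<^sub>\<le>\<^sub>1 xs. \<exists>us. VI_solution T C xs us"
      unfolding Uniq_def using unique by blast
    show "VI_solution_set T C \<noteq> {} \<longrightarrow> (\<exists>xs. VI_solution_set T C = {xs})"
      unfolding VI_solution_set_def using unique by blast
  qed
qed

end
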